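(* Let $\mathcal{T}=\mathcal{S}\times_1\mathbf{\Pi}_1\times_2\mathbf{\Pi}_2\times_3\mathbf{\Pi}_3\in\mathbb{R}^{p_1\times p_2\times p_3}$ be a tensor mixed-membership blockmodel, where $\mathcal{S}\in\mathbb{R}^{r_1\times r_2\times r_3}$ and each $\mathbf{\Pi}_k\in[0,1]^{p_k\times r_k}$ is a membership matrix. Suppose that each matricization $\mathcal{M}_k(\mathcal{S})$ has rank $r_k$, with $r_k\le r_{-k}$ for each $k$, and that there is a pure node for each community along each mode. Let $\mathcal{T}=\mathcal{C}\times_1\mathbf{U}_1\times_2\mathbf{U}_2\times_3\mathbf{U}_3$ denote its rank $(r_1,r_2,r_3)$ Tucker factorization. Then, for each $k$, $$\mathbf{U}_k=\mathbf{\Pi}_k\mathbf{U}_k^{(\mathrm{pure})},$$ where $\mathbf{U}_k^{(\mathrm{pure})}\in\mathbb{R}^{r_k\times r_k}$ has rank $r_k$ and contains the rows of $\mathbf{U}_k$ corresponding to pure nodes.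
   Context: A membership matrix is a matrix in $[0,1]^{p_k\times r_k}$ each of whose rows sums to one; its columns are the communities of mode $k$. An index $i$ is a pure node along mode $k$ for community $l$ if $(\mathbf{\Pi}_k)_{i\cdot}$ is the $l$-th standard basis vector. The matrix $\mathbf{U}_k^{(\mathrm{pure})}$ has as its $l$-th row the row of $\mathbf{U}_k$ indexed by a pure node of community $l$ along mode $k$. $\mathcal{M}_k$ denotes mode-$k$ matricization, $r_{-k}=\prod_{j\neq k}r_j$, and $\times_k$ is the standard mode-$k$ product. In the Tucker factorization, $\mathcal{C}\in\mathbb{R}^{r_1\times r_2\times r_3}$ is the core tensor and $\mathbf{U}_k\in\mathbb{R}^{p_k\times r_k}$ is the matrix with orthonormal columns given by the leading $r_k$ left singular vectors of $\mathcal{M}_k(\mathcal{T})$. *)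

theory Defs
  imports "HOL-Library.Numeral_Type" "Jordan_Normal_Form.DL_Rank"
begin

text \<open>
  The modes of an order-three tensor are the elements of the three-element type \<^typ>\<open>3\<close>, whose
  arithmetic is cyclic (so \<open>3 = 0\<close> and \<open>1, 2, 3\<close> are the three modes). A multi-index and a
  tuple of dimensions are functions on the modes. All coordinates are counted from 0. A tensor of
  dimensions \<open>d\<close> is a function on all multi-indices that vanishes outside the box given by \<open>d\<close>, so
  that equality of tensors of dimensions \<open>d\<close> is equality of functions.
\<close>

type_synonym tensor3 = "(3 \<Rightarrow> nat) \<Rightarrow> real"

definition tensor_carrier :: "(3 \<Rightarrow> nat) \<Rightarrow> tensor3 set" where
  "tensor_carrier d = {X. \<forall>i. \<not> (\<forall>k. i k < d k) \<longrightarrow> X i = 0}"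

text \<open>
  For a tensor of dimensions \<open>d\<close> with \<open>d k = dim_col A\<close>, the result has dimensions
  \<open>d(k := dim_row A)\<close>; the conditional keeps it zero outside that box.
\<close>

definition mode_product :: "tensor3 \<Rightarrow> 3 \<Rightarrow> real mat \<Rightarrow> tensor3"
    ("(_ \<times>\<^bsub>_\<^esub> _)" [70, 0, 71] 70) where
  "X \<times>\<^bsub>k\<^esub> A =
     (\<lambda>i. if i k < dim_row A then \<Sum>j<dim_col A. X (i(k := j)) * A $$ (i k, j) else 0)"

text \<open>
  The columns of the mode-\<open>k\<close> matricization are the mode-\<open>k\<close> fibres, listed in the cyclic order in
  which the index of mode \<open>k + 1\<close> varies fastest and that of mode \<open>k + 2\<close> slowest. Another
  enumeration of the fibres permutes the columns, which affects neither the rank nor the left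
  singular vectors.
\<close>

definition matricize :: "(3 \<Rightarrow> nat) \<Rightarrow> 3 \<Rightarrow> tensor3 \<Rightarrow> real mat" where
  "matricize d k X =
     mat (d k) (d (k + 1) * d (k + 2))
       (\<lambda>(a, b). X (\<lambda>m. if m = k then a
                        else if m = k + 1 then b mod d (k + 1)
                        else b div d (k + 1)))"

definition membership_matrix :: "real mat \<Rightarrow> bool" where
  "membership_matrix A \<longleftrightarrow>
     (\<forall>i<dim_row A. (\<forall>j<dim_col A. 0 \<le> A $$ (i, j) \<and> A $$ (i, j) \<le> 1) \<and>
                    (\<Sum>j<dim_col A. A $$ (i, j)) = 1)"

definition tensor_mixed_membership_blockmodel ::
  "(3 \<Rightarrow> nat) \<Rightarrow> (3 \<Rightarrow> nat) \<Rightarrow> tensor3 \<Rightarrow> tensor3 \<Rightarrow> (3 \<Rightarrow> real mat) \<Rightarrow> bool" where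
  "tensor_mixed_membership_blockmodel p r T S M \<longleftrightarrow>
     T \<in> tensor_carrier p \<and> S \<in> tensor_carrier r \<and>
     (\<forall>k. M k \<in> carrier_mat (p k) (r k) \<and> membership_matrix (M k)) \<and>
     T = S \<times>\<^bsub>1\<^esub> M 1 \<times>\<^bsub>2\<^esub> M 2 \<times>\<^bsub>3\<^esub> M 3"

definition pure_node :: "real mat \<Rightarrow> nat \<Rightarrow> nat \<Rightarrow> bool" where
  "pure_node A i l \<longleftrightarrow>
     i < dim_row A \<and> l < dim_col A \<and> row A i = unit_vec (dim_col A) l"

definition orthogonal_matrix :: "nat \<Rightarrow> real mat \<Rightarrow> bool" where
  "orthogonal_matrix n Q \<longleftrightarrow>
     Q \<in> carrier_mat n n \<and> transpose_mat Q * Q = 1\<^sub>m n \<and> Q * transpose_mat Q = 1\<^sub>m n"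

definition singular_value_decomposition ::
  "real mat \<Rightarrow> real mat \<Rightarrow> real mat \<Rightarrow> real mat \<Rightarrow> bool" where
  "singular_value_decomposition A W D V \<longleftrightarrow>
     orthogonal_matrix (dim_row A) W \<and> orthogonal_matrix (dim_col A) V \<and>
     D \<in> carrier_mat (dim_row A) (dim_col A) \<and> diagonal_mat D \<and>
     (\<forall>i < min (dim_row A) (dim_col A). 0 \<le> D $$ (i, i)) \<and>
     (\<forall>j < min (dim_row A) (dim_col A). \<forall>i\<le>j. D $$ (j, j) \<le> D $$ (i, i)) \<and>
     A = W * D * transpose_mat V"

text \<open>
  Singular vectors are not unique, so having the leading \<open>r\<close> left singular vectors as columns is a
  predicate on \<open>U\<close> rather than a function of \<open>A\<close>.
\<close>

definition leading_left_singular_vectors :: "nat \<Rightarrow> real mat \<Rightarrow> real mat \<Rightarrow> bool" where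
  "leading_left_singular_vectors r A U \<longleftrightarrow>
     r \<le> dim_row A \<and>
     (\<exists>W D V. singular_value_decomposition A W D V \<and>
              U = mat (dim_row A) r (\<lambda>(i, j). W $$ (i, j)))"

definition tucker_factorization ::
  "(3 \<Rightarrow> nat) \<Rightarrow> (3 \<Rightarrow> nat) \<Rightarrow> tensor3 \<Rightarrow> tensor3 \<Rightarrow> (3 \<Rightarrow> real mat) \<Rightarrow> bool" where
  "tucker_factorization p r T C U \<longleftrightarrow>
     T \<in> tensor_carrier p \<and> C \<in> tensor_carrier r \<and>
     (\<forall>k. leading_left_singular_vectors (r k) (matricize p k T) (U k)) \<and>
     T = C \<times>\<^bsub>1\<^esub> U 1 \<times>\<^bsub>2\<^esub> U 2 \<times>\<^bsub>3\<^esub> U 3"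

text \<open>
  The matrix whose \<open>l\<close>-th row is row \<open>\<iota> l\<close> of \<open>U\<close>, for \<open>l < n\<close>.
\<close>

definition select_rows :: "nat \<Rightarrow> (nat \<Rightarrow> nat) \<Rightarrow> real mat \<Rightarrow> real mat" where
  "select_rows n \<iota> U = mat n (dim_col U) (\<lambda>(l, j). U $$ (\<iota> l, j))"

end

theory Submission
  imports Defs
begin

text \<open>
  Restricting both factorizations of the tensor to pure nodes in the two modes other than \<open>k\<close> turns
  the blockmodel into \<open>M k * matricize r k S\<close>, and the Tucker factorization into \<open>U k * H\<close> for some
  matrix \<open>H\<close>. Since \<open>matricize r k S\<close> has full row rank, it has a right inverse, whence
  \<open>M k = U k * E\<close> with \<open>E\<close> square. Selecting the pure rows of mode \<open>k\<close> turns the left-hand side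
  into the identity, so the pure rows of \<open>U k\<close> form a left inverse of \<open>E\<close>, hence also a right
  inverse, and \<open>U k\<close> is \<open>M k\<close> times these rows.
\<close>

text \<open>A maximal independent set of columns has \<open>n\<close> elements, hence is a basis, so
  the columns span the whole space. Solving \<open>A *\<^sub>v x = unit_vec n j\<close> for each
  \<open>j\<close> gives the columns of a right inverse.\<close>

lemma full_row_rank_right_inverse:
  fixes A :: "'a :: field mat"
  assumes A: "A \<in> carrier_mat n nc" and rank: "vec_space.rank n A = n"
  obtains B where "B \<in> carrier_mat nc n" "A * B = 1\<^sub>m n"
proof -
  interpret vec_space "TYPE('a)" n .
  obtain X where X: "maximal X (\<lambda>T. T \<subseteq> set (cols A) \<and> lin_indpt T)"
    using maximal_exists_superset[of "set (cols A)" "\<lambda>T. T \<subseteq> set (cols A) \<and> lin_indpt T" "{}"]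
    by (auto simp: lin_dep_def)
  then have sub: "X \<subseteq> set (cols A)" and indpt: "lin_indpt X"
    by (auto simp: maximal_def)
  have cols: "set (cols A) \<subseteq> carrier_vec n"
    using A cols_dim by blast
  have "card X = n"
    using rank rank_card_indpt[OF A X] by simp
  then have "basis X"
    using sub cols indpt by (intro dim_li_is_basis) (auto simp: dim_is_n intro: finite_subset)
  then have "carrier_vec n \<subseteq> col_space A"
    using span_is_monotone[OF sub] by (auto simp: basis_def col_space_def)
  then have "\<exists>x\<in>carrier_vec nc. A *\<^sub>v x = unit_vec n j" for j
    using A col_space_eq[OF A] by (auto dest: subsetD[of _ _ "unit_vec n j"])
  then obtain x where x: "\<And>j. x j \<in> carrier_vec nc" "\<And>j. A *\<^sub>v x j = unit_vec n j"
    by metis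
  define B where "B = mat nc n (\<lambda>(i, j). x j $ i)"
  have B: "B \<in> carrier_mat nc n"
    by (simp add: B_def)
  have col_B: "col B j = x j" if "j < n" for j
    using that carrier_vecD[OF x(1)] by (auto simp: B_def)
  have "(A * B) $$ (i, j) = 1\<^sub>m n $$ (i, j)" if "i < n" "j < n" for i j
  proof -
    have "(A * B) $$ (i, j) = (A *\<^sub>v col B j) $ i"
      using that A B by simp
    then show ?thesis
      using that x(2) col_B by simp
  qed
  then have "A * B = 1\<^sub>m n"
    using A B by (intro eq_matI) auto
  with B show thesis by (rule that)
qed

lemma mode_cases:
  fixes k :: 3
  obtains "k = 1" | "k = 2" | "k = 3"
proof (induct k)
  case (of_int z)
  then have "z = 0 \<or> z = 1 \<or> z = 2" by fastforce
  \<comment> \<open>The value \<open>z = 0\<close> gives the case \<open>k = 3\<close>, since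
    \<open>3 = 0\<close> in this type.\<close>
  with of_int show ?case by auto
qed

lemma succ_modes_distinct [simp]:
  fixes k :: 3
  shows "k + 1 \<noteq> k" "k + 2 \<noteq> k" "k + 2 \<noteq> k + 1"
    "k \<noteq> k + 1" "k \<noteq> k + 2" "k + 1 \<noteq> k + 2"
  by (cases k rule: mode_cases; simp)+

text \<open>Updates at distinct modes commute, so both sides are the same finite double sum with the
  order of summation exchanged.\<close>

lemma mode_product_commute:
  assumes "k \<noteq> l"
  shows "X \<times>\<^bsub>k\<^esub> A \<times>\<^bsub>l\<^esub> B = X \<times>\<^bsub>l\<^esub> B \<times>\<^bsub>k\<^esub> A"
proof
  fix i
  have "(\<Sum>b<dim_col B. (\<Sum>a<dim_col A. X (i(l := b, k := a)) * A $$ (i k, a)) * B $$ (i l, b)) =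
      (\<Sum>a<dim_col A. (\<Sum>b<dim_col B. X (i(k := a, l := b)) * B $$ (i l, b)) * A $$ (i k, a))"
    unfolding sum_distrib_right
    by (subst sum.swap) (simp add: fun_upd_twist[OF assms] mult_ac)
  then show "(X \<times>\<^bsub>k\<^esub> A \<times>\<^bsub>l\<^esub> B) i = (X \<times>\<^bsub>l\<^esub> B \<times>\<^bsub>k\<^esub> A) i"
    using assms assms[symmetric] by (simp add: mode_product_def)
qed

text \<open>Commuting the products brings mode \<open>k\<close> to the outside, so that one argument
  serves all three modes. The order of the other two matches the convention of
  \<open>matricize\<close>.\<close>

lemma mode_product_cyclic:
  fixes k :: 3
  shows "X \<times>\<^bsub>1\<^esub> A 1 \<times>\<^bsub>2\<^esub> A 2 \<times>\<^bsub>3\<^esub> A 3 =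
    X \<times>\<^bsub>k + 1\<^esub> A (k + 1) \<times>\<^bsub>k + 2\<^esub> A (k + 2) \<times>\<^bsub>k\<^esub> A k"
proof (cases k rule: mode_cases)
  case 1
  have "X \<times>\<^bsub>1\<^esub> A 1 \<times>\<^bsub>2\<^esub> A 2 \<times>\<^bsub>3\<^esub> A 3 = X \<times>\<^bsub>2\<^esub> A 2 \<times>\<^bsub>3\<^esub> A 3 \<times>\<^bsub>1\<^esub> A 1"
    by (simp add: mode_product_commute[of 1])
  then show ?thesis using 1 by simp
next
  case 2
  have "X \<times>\<^bsub>1\<^esub> A 1 \<times>\<^bsub>2\<^esub> A 2 \<times>\<^bsub>3\<^esub> A 3 = X \<times>\<^bsub>3\<^esub> A 3 \<times>\<^bsub>1\<^esub> A 1 \<times>\<^bsub>2\<^esub> A 2"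
    by (simp add: mode_product_commute[of _ 3])
  moreover have succ: "k + 1 = 3" "k + 2 = 1" using 2 by simp_all
  ultimately show ?thesis unfolding succ by (simp only: 2)
next
  case 3
  then have succ: "k + 1 = 1" "k + 2 = 2" by simp_all
  show ?thesis unfolding succ by (simp only: 3)
qed

lemma pure_node_entry:
  assumes "pure_node A i l" "j < dim_col A"
  shows "A $$ (i, j) = (if j = l then 1 else 0)"
proof -
  have "i < dim_row A" and row: "row A i = unit_vec (dim_col A) l"
    using assms(1) by (simp_all add: pure_node_def)
  then have "A $$ (i, j) = row A i $ j"
    using assms(2) by (intro index_row(1)[symmetric])
  then show ?thesis
    using assms(2) row by (simp add: unit_vec_def)
qed

text \<open>The row of \<open>A\<close> at a pure node is a unit vector, so the sum collapses to a
  single entry of \<open>X\<close>.\<close>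

lemma mode_product_pure_node:
  assumes "pure_node A (i k) l"
  shows "(X \<times>\<^bsub>k\<^esub> A) i = X (i(k := l))"
proof -
  have "(X \<times>\<^bsub>k\<^esub> A) i = (\<Sum>j<dim_col A. X (i(k := j)) * (if j = l then 1 else 0))"
    using assms pure_node_entry[OF assms] by (simp add: mode_product_def pure_node_def)
  also have "\<dots> = X (i(k := l))"
    using assms by (simp add: pure_node_def if_distrib cong: if_cong)
  finally show ?thesis .
qed

lemma matrix_factor_pure_rows:
  fixes A U :: "real mat"
  assumes A: "A \<in> carrier_mat n r" and U: "U \<in> carrier_mat n r" and E: "E \<in> carrier_mat r r"
    and factor: "A = U * E" and pure: "\<forall>l<r. pure_node A (\<iota> l) l"
  shows "vec_space.rank r (select_rows r \<iota> U) = r" "U = A * select_rows r \<iota> U"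
proof -
  let ?P = "select_rows r \<iota> U"
  have P: "?P \<in> carrier_mat r r"
    using U by (simp add: select_rows_def)
  have "(?P * E) $$ (l, j) = 1\<^sub>m r $$ (l, j)" if "l < r" "j < r" for l j
  proof -
    have "\<iota> l < n"
      using pure that A by (auto simp: pure_node_def)
    then have "row ?P l = row U (\<iota> l)"
      using U that by (auto simp: select_rows_def)
    then have "(?P * E) $$ (l, j) = (U * E) $$ (\<iota> l, j)"
      using that P E U \<open>\<iota> l < n\<close> by simp
    also have "\<dots> = A $$ (\<iota> l, j)"
      by (simp only: factor)
    also have "\<dots> = 1\<^sub>m r $$ (l, j)"
      using pure_node_entry[of A "\<iota> l" l j] pure that A by auto
    finally show ?thesis .
  qed
  then have PE: "?P * E = 1\<^sub>m r"
    using P E by (intro eq_matI) auto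
  \<comment> \<open>For square matrices a left inverse is also a right inverse.\<close>
  then have EP: "E * ?P = 1\<^sub>m r"
    using mat_mult_left_right_inverse P E by blast
  show "U = A * ?P"
    unfolding factor using assoc_mult_mat[OF U E P] EP U by simp
  have "det ?P \<noteq> 0"
    using det_mult[OF P E] PE by auto
  then show "vec_space.rank r ?P = r"
    using vec_space.det_rank_iff[OF P] by blast
qed

theorem proposition2:
  fixes p r :: "3 \<Rightarrow> nat"
    and T S C :: tensor3
    and M U :: "3 \<Rightarrow> real mat"
  assumes "tensor_mixed_membership_blockmodel p r T S M"
    and "\<forall>k. vec_space.rank (r k) (matricize r k S) = r k"
    and "\<forall>k. r k \<le> (\<Prod>j\<in>UNIV - {k}. r j)"
    and "\<forall>k. \<forall>l<r k. \<exists>i. pure_node (M k) i l"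
    and "tucker_factorization p r T C U"
  shows "\<forall>k. \<forall>\<iota>. (\<forall>l<r k. pure_node (M k) (\<iota> l) l) \<longrightarrow>
           select_rows (r k) \<iota> (U k) \<in> carrier_mat (r k) (r k) \<and>
           vec_space.rank (r k) (select_rows (r k) \<iota> (U k)) = r k \<and>
           U k = M k * select_rows (r k) \<iota> (U k)"
proof (intro allI impI)
  fix k \<iota>
  assume pure: "\<forall>l<r k. pure_node (M k) (\<iota> l) l"
  have M: "M m \<in> carrier_mat (p m) (r m)" for m
    using assms(1) by (simp add: tensor_mixed_membership_blockmodel_def)
  have U: "U m \<in> carrier_mat (p m) (r m)" for m
  proof -
    have "leading_left_singular_vectors (r m) (matricize p m T) (U m)"
      using assms(5) unfolding tucker_factorization_def by blast
    then show ?thesis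
      by (auto simp: leading_left_singular_vectors_def matricize_def)
  qed
  define Y where "Y = S \<times>\<^bsub>k + 1\<^esub> M (k + 1) \<times>\<^bsub>k + 2\<^esub> M (k + 2)"
  define Z where "Z = C \<times>\<^bsub>k + 1\<^esub> U (k + 1) \<times>\<^bsub>k + 2\<^esub> U (k + 2)"
  have TM: "T = Y \<times>\<^bsub>k\<^esub> M k"
    using assms(1) mode_product_cyclic[of S M k]
    by (simp add: tensor_mixed_membership_blockmodel_def Y_def)
  have TU: "T = Z \<times>\<^bsub>k\<^esub> U k"
    using assms(5) mode_product_cyclic[of C U k]
    by (simp add: tucker_factorization_def Z_def)
  \<comment> \<open>A fixed choice of pure nodes in every mode; it serves modes \<open>k + 1\<close>
    and \<open>k + 2\<close>, while mode \<open>k\<close> keeps the arbitrary choice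
    \<open>\<iota>\<close>.\<close>
  obtain \<nu> where \<nu>: "\<And>m l. l < r m \<Longrightarrow> pure_node (M m) (\<nu> m l) l"
    using assms(4) by metis
  let ?q = "r (k + 1) * r (k + 2)"
  \<comment> \<open>Column \<open>b\<close> of \<open>matricize r k S\<close> encodes a pair of
    communities; \<open>x a b\<close> replaces them by their pure nodes. Coordinate \<open>a\<close>
    is a node when \<open>T\<close> is evaluated, but a community when \<open>Y\<close> or
    \<open>Z\<close> is.\<close>
  define x where "x = (\<lambda>a b m. if m = k then a
    else if m = k + 1 then \<nu> (k + 1) (b mod r (k + 1)) else \<nu> (k + 2) (b div r (k + 1)))"
  define H where "H = mat (r k) ?q (\<lambda>(a, b). Z (x a b))"
  have x_upd: "(x a b)(k := j) = x j b" and x_k: "x a b k = a" for a b j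
    by (auto simp: x_def)
  have Y_pure: "Y (x a b) = matricize r k S $$ (a, b)" if "a < r k" "b < ?q" for a b
  proof -
    \<comment> \<open>Otherwise there would be no column \<open>b\<close>; positivity makes the
      remainder a valid community.\<close>
    have "0 < r (k + 1)"
      using that by (intro gr0I) simp
    then have "b mod r (k + 1) < r (k + 1)" by simp
    then have 1: "pure_node (M (k + 1)) (\<nu> (k + 1) (b mod r (k + 1))) (b mod r (k + 1))"
      by (rule \<nu>)
    have "b div r (k + 1) < r (k + 2)"
      using that by (simp add: less_mult_imp_div_less mult.commute)
    then have 2: "pure_node (M (k + 2)) (\<nu> (k + 2) (b div r (k + 1))) (b div r (k + 1))"
      by (rule \<nu>)
    \<comment> \<open>Each product evaluated at a pure node turns that node back into its community,
      the outer mode \<open>k + 2\<close> first.\<close>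
    have "Y (x a b) = S ((x a b)(k + 2 := b div r (k + 1), k + 1 := b mod r (k + 1)))"
      unfolding Y_def
      using 1 2 by (simp add: mode_product_pure_node x_def)
    also have "(x a b)(k + 2 := b div r (k + 1), k + 1 := b mod r (k + 1)) =
        (\<lambda>m. if m = k then a else if m = k + 1 then b mod r (k + 1) else b div r (k + 1))"
    proof
      fix m
      show "((x a b)(k + 2 := b div r (k + 1), k + 1 := b mod r (k + 1))) m =
        (if m = k then a else if m = k + 1 then b mod r (k + 1) else b div r (k + 1))"
        by (cases k rule: mode_cases; cases m rule: mode_cases; simp add: x_def)
    qed
    finally show ?thesis
      using that by (simp add: matricize_def)
  qed
  have S: "matricize r k S \<in> carrier_mat (r k) ?q"
    by (simp add: matricize_def)
  have H: "H \<in> carrier_mat (r k) ?q"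
    by (simp add: H_def)
  have "(M k * matricize r k S) $$ (a, b) = (U k * H) $$ (a, b)" if "a < p k" "b < ?q" for a b
  proof -
    have "(M k * matricize r k S) $$ (a, b) = (\<Sum>j<r k. M k $$ (a, j) * matricize r k S $$ (j, b))"
      using that M[of k] S by (simp add: scalar_prod_def lessThan_atLeast0)
    \<comment> \<open>Expanding \<open>T\<close> along mode \<open>k\<close> only varies the first
      argument of \<open>x\<close>, and there \<open>Y\<close> agrees with the matricized
      core.\<close>
    also have "\<dots> = T (x a b)"
      using that M[of k] by (simp add: TM mode_product_def x_upd x_k Y_pure mult.commute)
    also have "\<dots> = (\<Sum>j<r k. U k $$ (a, j) * H $$ (j, b))"
      using that U[of k] by (simp add: TU mode_product_def x_upd x_k H_def mult.commute)
    also have "\<dots> = (U k * H) $$ (a, b)"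
      using that U[of k] H by (simp add: scalar_prod_def lessThan_atLeast0)
    finally show ?thesis .
  qed
  then have eq: "M k * matricize r k S = U k * H"
    using M[of k] U[of k] S H by (intro eq_matI) auto
  obtain R where R: "R \<in> carrier_mat ?q (r k)" "matricize r k S * R = 1\<^sub>m (r k)"
    using full_row_rank_right_inverse[OF S] assms(2) by blast
  have "M k = M k * (matricize r k S * R)"
    using M[of k] R(2) by simp
  also have "\<dots> = U k * H * R"
    using assoc_mult_mat[OF M S R(1)] eq by simp
  also have "\<dots> = U k * (H * R)"
    using assoc_mult_mat[OF U H R(1)] .
  finally have factor: "M k = U k * (H * R)" .
  have "H * R \<in> carrier_mat (r k) (r k)"
    using H R(1) by simp
  from matrix_factor_pure_rows[OF M U this factor pure]
  show "select_rows (r k) \<iota> (U k) \<in> carrier_mat (r k) (r k) \<and>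
      vec_space.rank (r k) (select_rows (r k) \<iota> (U k)) = r k \<and>
      U k = M k * select_rows (r k) \<iota> (U k)"
    using U[of k] by (simp add: select_rows_def)
qed

end
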